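(* Let $n \geqslant 1$ be an integer and let $\sigma = (1, \lambda_2, \ldots, \lambda_n)$ be a $1/2$-Suleĭmanova spectrum, that is, a list of real numbers with $\lambda_j \leqslant 0$ for $j = 2, \ldots, n$ and $$1 + \lambda_2 + \ldots + \lambda_n \geqslant \tfrac12.$$ Then there exists a symmetric, doubly stochastic $n\times n$ matrix whose spectrum is precisely $\sigma$.
   Context: A square matrix with real entries is stochastic if all its entries are non-negative and each row adds up to $1$; a stochastic matrix is doubly stochastic if its transpose is stochastic too. For $\delta>0$, a list of real numbers $(1,\lambda_2,\ldots,\lambda_n)$ is called a $\delta$-Suleĭmanova spectrum if $\lambda_j\leqslant 0$ for $j=2,\ldots,n$ and $1+\lambda_2+\ldots+\lambda_n\geqslant\delta$ (the list is not assumed to be ordered). The spectrum of an $n \times n$ matrix is understood as the list of its eigenvalues counted with multiplicity (up to reordering). *)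

theory Defs
  imports
    "HOL-Computational_Algebra.Fundamental_Theorem_Algebra"
    "Jordan_Normal_Form.Char_Poly"
begin

definition stochastic_mat :: "real mat \<Rightarrow> bool" where
  "stochastic_mat A \<longleftrightarrow>
     square_mat A \<and>
     (\<forall>i<dim_row A. \<forall>j<dim_col A. 0 \<le> A $$ (i, j)) \<and>
     (\<forall>i<dim_row A. (\<Sum>j<dim_col A. A $$ (i, j)) = 1)"

definition doubly_stochastic_mat :: "real mat \<Rightarrow> bool" where
  "doubly_stochastic_mat A \<longleftrightarrow> stochastic_mat A \<and> stochastic_mat (transpose_mat A)"

definition symmetric_mat :: "'a mat \<Rightarrow> bool" where
  "symmetric_mat A \<longleftrightarrow> transpose_mat A = A"

definition suleimanova_spectrum :: "real \<Rightarrow> real list \<Rightarrow> bool" where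
  "suleimanova_spectrum \<delta> \<sigma> \<longleftrightarrow>
     \<delta> > 0 \<and>
     (\<exists>ls. \<sigma> = 1 # ls \<and> (\<forall>x\<in>set ls. x \<le> 0) \<and> 1 + sum_list ls \<ge> \<delta>)"

text \<open>
  All complex eigenvalues of a real matrix, counted with algebraic multiplicity. Working over
  the complex numbers makes the multiset of an $n \times n$ matrix have exactly $n$ elements.
  A multiset is a list up to reordering.
\<close>

definition eigenvalue_mset :: "real mat \<Rightarrow> complex multiset" where
  "eigenvalue_mset A = proots (char_poly (map_mat complex_of_real A))"

definition has_spectrum :: "real mat \<Rightarrow> real list \<Rightarrow> bool" where
  "has_spectrum A \<sigma> \<longleftrightarrow> eigenvalue_mset A = image_mset complex_of_real (mset \<sigma>)"

end

theory Submission
  imports Defs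
begin

text \<open>
  A symmetric matrix with spectrum \<open>\<sigma> = (1, \<lambda>\<^sub>2, \<dots>, \<lambda>\<^sub>n)\<close> is obtained by conjugating the diagonal
  matrix of \<open>\<sigma>\<close> with an orthogonal matrix. The point is to choose one whose column for the
  eigenvalue \<open>1\<close> is constant, so that rows add up to \<open>1\<close>, and whose other entries are as evenly
  spread as possible, so that the negative eigenvalues cannot produce a negative entry.

  The discrete Hartley transform \<open>H\<close>, with entries \<open>(cos t + sin t) / sqrt n\<close> at
  \<open>t = 2 \<pi> i k / n\<close>, does this in every dimension. It is symmetric and satisfies \<open>H\<^sup>2 = 1\<close>
  (\<open>hartley_orthogonal\<close>), by the vanishing of sums of roots of unity. Since
  \<open>|cos t + sin t| \<le> sqrt 2\<close>, the product of any two entries is at most \<open>2 / n\<close>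
  (\<open>hartley_mult_le\<close>). Hence the entries of \<open>H diag(\<sigma>) H\<close> are at least
  \<open>(1 + 2 (\<lambda>\<^sub>2 + \<dots> + \<lambda>\<^sub>n)) / n\<close>, which is nonnegative exactly when
  \<open>1 + \<lambda>\<^sub>2 + \<dots> + \<lambda>\<^sub>n \<ge> 1/2\<close>.
\<close>

definition hartley :: "nat \<Rightarrow> nat \<Rightarrow> nat \<Rightarrow> real" where
  "hartley n i k =
     (cos (2 * pi * real i * real k / real n) + sin (2 * pi * real i * real k / real n)) / sqrt (real n)"

lemma hartley_commute: "hartley n i k = hartley n k i"
  by (simp add: hartley_def mult_ac)

lemma hartley_0_right [simp]: "hartley n i 0 = 1 / sqrt (real n)"
  by (simp add: hartley_def)

lemma sum_power_root_of_unity: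
  fixes z :: complex
  assumes "z ^ n = 1"
  shows "(\<Sum>k<n. z ^ k) = (if z = 1 then of_nat n else 0)"
  using assms by (simp add: sum_gp_strict)

lemma cis_eq_1_imp_dvd:
  fixes m :: int
  assumes "n > 0" and "cis (2 * pi * of_int m / real n) = 1"
  shows "int n dvd m"
proof -
  have "cos (2 * pi * of_int m / real n) = 1"
    using assms(2) by (metis cis.sel(1) one_complex.sel(1))
  then obtain x :: int where "2 * pi * of_int m / real n = of_int x * 2 * pi"
    using cos_one_2pi_int by blast
  then have "real_of_int m = real_of_int (x * int n)"
    using assms(1) by (simp add: field_simps)
  then have "m = x * int n"
    by (simp only: of_int_eq_iff)
  then show ?thesis by simp
qed

lemma sum_cis_multiples:
  fixes m :: int
  assumes n: "n > 0"
  shows "(\<Sum>k<n. cis (2 * pi * of_int m * real k / real n)) = (if int n dvd m then of_nat n else 0)"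
proof -
  define z where "z = cis (2 * pi * of_int m / real n)"
  have pow: "z ^ k = cis (2 * pi * of_int m * real k / real n)" for k
    by (simp add: z_def DeMoivre mult_ac)
  have "z ^ n = cis (2 * pi * of_int m)"
    using n by (simp add: pow)
  then have zn: "z ^ n = 1"
    by (simp add: cis_multiple_2pi)
  have "z = 1" if "int n dvd m"
  proof -
    from that obtain x where "m = int n * x" ..
    then have "2 * pi * of_int m / real n = 2 * pi * of_int x"
      using n by simp
    then show ?thesis by (simp only: z_def cis_multiple_2pi Ints_of_int)
  qed
  then have "z = 1 \<longleftrightarrow> int n dvd m"
    using cis_eq_1_imp_dvd[OF n, of m] by (auto simp: z_def)
  then show ?thesis
    using sum_power_root_of_unity[OF zn] by (simp add: pow)
qed

lemma sum_cos_multiples: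
  fixes m :: int
  assumes "n > 0"
  shows "(\<Sum>k<n. cos (2 * pi * of_int m * real k / real n)) = (if int n dvd m then real n else 0)"
  using arg_cong[OF sum_cis_multiples[OF assms, of m], of Re] by (simp split: if_splits)

lemma sum_sin_multiples:
  fixes m :: int
  assumes "n > 0"
  shows "(\<Sum>k<n. sin (2 * pi * of_int m * real k / real n)) = 0"
  using arg_cong[OF sum_cis_multiples[OF assms, of m], of Im] by (simp split: if_splits)

text \<open>
  The sine terms sum to zero at every frequency, while the cosine terms survive only at
  frequencies divisible by \<open>n\<close>; a difference of two indices below \<open>n\<close> is one only if it is zero.
\<close>

lemma hartley_orthogonal:
  assumes i: "i < n" and j: "j < n"
  shows "(\<Sum>k<n. hartley n i k * hartley n k j) = (if i = j then 1 else 0)"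
proof -
  have n: "n > 0" using i by simp
  have cas: "(cos a + sin a) * (cos b + sin b) = cos (a - b) + sin (a + b)" for a b :: real
    by (simp add: cos_diff sin_add algebra_simps)
  have "hartley n i k * hartley n k j =
      (cos (2 * pi * of_int (int i - int j) * real k / real n) +
       sin (2 * pi * of_int (int i + int j) * real k / real n)) / real n" for k
  proof -
    let ?a = "2 * pi * real i * real k / real n" and ?b = "2 * pi * real j * real k / real n"
    have "hartley n i k * hartley n k j =
        ((cos ?a + sin ?a) * (cos ?b + sin ?b)) / (sqrt (real n) * sqrt (real n))"
      unfolding hartley_commute[of n k j] by (simp add: hartley_def)
    also have "\<dots> = (cos (?a - ?b) + sin (?a + ?b)) / real n"
      by (simp only: cas real_sqrt_mult_self abs_of_nat)
    also have "?a - ?b = 2 * pi * of_int (int i - int j) * real k / real n"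
      by (simp add: diff_divide_distrib algebra_simps)
    also have "?a + ?b = 2 * pi * of_int (int i + int j) * real k / real n"
      by (simp add: add_divide_distrib algebra_simps)
    finally show ?thesis .
  qed
  then have "(\<Sum>k<n. hartley n i k * hartley n k j) =
      ((\<Sum>k<n. cos (2 * pi * of_int (int i - int j) * real k / real n)) +
       (\<Sum>k<n. sin (2 * pi * of_int (int i + int j) * real k / real n))) / real n"
    by (simp only: sum.distrib flip: sum_divide_distrib)
  also have "\<dots> = (if int n dvd int i - int j then 1 else 0)"
    using n by (simp only: sum_cos_multiples sum_sin_multiples) simp
  also have "int n dvd int i - int j \<longleftrightarrow> i = j"
    using i j mod_eq_dvd_iff[of "int i" "int n" "int j"] by simp
  finally show ?thesis .
qed

text \<open>By the inequality of arithmetic and geometric means and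
  \<open>(cos t + sin t)\<^sup>2 = 1 + sin (2 t) \<le> 2\<close>.\<close>

lemma hartley_mult_le: "hartley n i k * hartley n j l \<le> 2 / real n"
proof -
  have sq: "(hartley n i k)\<^sup>2 \<le> 2 / real n" for i k
  proof -
    have "(cos t + sin t)\<^sup>2 \<le> 2" for t :: real
      using sin_le_one[of "2 * t"] sin_cos_squared_add[of t]
      unfolding sin_double power2_sum by (simp only: mult_ac)
    then show ?thesis
      by (simp add: hartley_def power_divide divide_right_mono)
  qed
  have "0 \<le> (hartley n i k - hartley n j l)\<^sup>2" by simp
  then show ?thesis
    using sq[of i k] sq[of j l] by (simp add: power2_diff)
qed

definition hartley_mat :: "nat \<Rightarrow> real mat" where
  "hartley_mat n = mat n n (\<lambda>(i, k). hartley n i k)"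

lemma hartley_mat_carrier [simp]: "hartley_mat n \<in> carrier_mat n n"
  by (simp add: hartley_mat_def)

lemma hartley_mat_involution: "hartley_mat n * hartley_mat n = 1\<^sub>m n"
  by (rule eq_matI)
    (auto simp: hartley_mat_def scalar_prod_def hartley_orthogonal simp flip: lessThan_atLeast0)

definition hartley_conj :: "real list \<Rightarrow> real mat" where
  "hartley_conj \<sigma> =
     (let n = length \<sigma> in hartley_mat n * mat_diag n ((!) \<sigma>) * hartley_mat n)"

lemma hartley_conj_carrier [simp]: "hartley_conj \<sigma> \<in> carrier_mat (length \<sigma>) (length \<sigma>)"
  unfolding hartley_conj_def Let_def by (intro mult_carrier_mat[of _ _ "length \<sigma>"]) simp_all

lemma hartley_conj_dim [simp]:
  "dim_row (hartley_conj \<sigma>) = length \<sigma>" "dim_col (hartley_conj \<sigma>) = length \<sigma>"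
  using hartley_conj_carrier[of \<sigma>] by (auto simp del: hartley_conj_carrier)

lemma hartley_conj_index:
  assumes "i < length \<sigma>" "j < length \<sigma>"
  shows "hartley_conj \<sigma> $$ (i, j) =
    (\<Sum>k<length \<sigma>. \<sigma> ! k * (hartley (length \<sigma>) i k * hartley (length \<sigma>) k j))"
  unfolding hartley_conj_def Let_def mat_diag_mult_right[OF hartley_mat_carrier]
  using assms
  by (auto simp: hartley_mat_def scalar_prod_def lessThan_atLeast0 mult_ac intro!: sum.cong)

lemma hartley_conj_symmetric: "symmetric_mat (hartley_conj \<sigma>)"
  unfolding symmetric_mat_def
  by (rule eq_matI)
    (auto simp: hartley_conj_index hartley_commute[of "length \<sigma>"] mult_ac intro!: sum.cong)

lemma has_spectrum_if_similar_diag: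
  assumes A: "A \<in> carrier_mat (length \<sigma>) (length \<sigma>)"
    and sim: "similar_mat A (mat_diag (length \<sigma>) ((!) \<sigma>))"
  shows "has_spectrum A \<sigma>"
proof -
  let ?D = "mat_diag (length \<sigma>) ((!) \<sigma>)"
  have "diag_mat ?D = \<sigma>"
    by (rule nth_equalityI) (auto simp: diag_mat_def mat_diag_def)
  moreover have "upper_triangular ?D"
    by (auto simp: mat_diag_def upper_triangular_def)
  ultimately have "char_poly A = (\<Prod>a\<leftarrow>\<sigma>. [:- a, 1:])"
    using char_poly_similar[OF sim] char_poly_upper_triangular[of ?D "length \<sigma>"] by simp
  moreover have "map_poly complex_of_real (\<Prod>a\<leftarrow>xs. [:- a, 1:]) =
      (\<Prod>a\<leftarrow>xs. [:- complex_of_real a, 1:])" for xs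
  proof -
    interpret map_poly_hom: map_poly_comm_ring_hom complex_of_real ..
    show ?thesis by (induction xs) (simp_all add: map_poly_hom.hom_mult del: mult_pCons_left)
  qed
  moreover have "proots (\<Prod>a\<leftarrow>xs. [:- complex_of_real a, 1:]) =
      image_mset complex_of_real (mset xs)" for xs
  proof (induction xs)
    case (Cons a xs)
    have "(\<Prod>a\<leftarrow>xs. [:- complex_of_real a, 1:]) \<noteq> 0"
      by (auto simp: prod_list_zero_iff)
    then show ?case
      using Cons.IH by (simp add: proots_mult del: mult_pCons_left)
  qed simp
  ultimately show ?thesis
    by (simp add: has_spectrum_def eigenvalue_mset_def of_real_hom.char_poly_hom[OF A])
qed

lemma hartley_conj_has_spectrum: "has_spectrum (hartley_conj \<sigma>) \<sigma>"
proof (rule has_spectrum_if_similar_diag)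
  let ?n = "length \<sigma>"
  show "similar_mat (hartley_conj \<sigma>) (mat_diag ?n ((!) \<sigma>))"
    by (rule similar_matI[OF _ hartley_mat_involution hartley_mat_involution])
      (use hartley_conj_carrier[of \<sigma>] in \<open>auto simp: hartley_conj_def Let_def\<close>)
qed simp

text \<open>The constant vector is \<open>sqrt n\<close> times column \<open>0\<close> of the Hartley matrix, so by
  orthogonality it is an eigenvector for the first entry of \<open>\<sigma>\<close>.\<close>

lemma hartley_conj_row_sum:
  assumes i: "i < length \<sigma>"
  shows "(\<Sum>j<length \<sigma>. hartley_conj \<sigma> $$ (i, j)) = \<sigma> ! 0"
proof -
  define n where "n = length \<sigma>"
  have n: "n > 0" "i < n" using i by (auto simp: n_def)
  have col: "(\<Sum>j<n. hartley n k j) = (if k = 0 then sqrt (real n) else 0)" if "k < n" for k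
  proof -
    have "(\<Sum>j<n. hartley n k j) / sqrt (real n) = (if k = 0 then 1 else 0)"
      using hartley_orthogonal[OF that n(1)] by (simp add: sum_divide_distrib)
    then show ?thesis using n by (simp add: field_simps split: if_splits)
  qed
  have "(\<Sum>j<n. hartley_conj \<sigma> $$ (i, j)) =
      (\<Sum>j<n. \<Sum>k<n. \<sigma> ! k * (hartley n i k * hartley n k j))"
    using n by (simp add: n_def hartley_conj_index)
  also have "\<dots> = (\<Sum>k<n. \<sigma> ! k * hartley n i k * (\<Sum>j<n. hartley n k j))"
    by (subst sum.swap) (simp add: sum_distrib_left mult.assoc)
  also have "\<dots> = (\<Sum>k<n. if k = 0 then \<sigma> ! 0 * hartley n i 0 * sqrt (real n) else 0)"
    by (intro sum.cong) (simp_all add: col)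
  also have "\<dots> = \<sigma> ! 0"
    using n(1) by (simp only: sum.delta' sum.delta finite_lessThan lessThan_iff) simp
  finally show ?thesis by (simp add: n_def)
qed

lemma hartley_conj_nonneg:
  assumes \<sigma>: "suleimanova_spectrum (1/2) \<sigma>" and i: "i < length \<sigma>" and j: "j < length \<sigma>"
  shows "0 \<le> hartley_conj \<sigma> $$ (i, j)"
proof -
  obtain ls where ls: "\<sigma> = 1 # ls" "\<And>x. x \<in> set ls \<Longrightarrow> x \<le> 0" "1 + sum_list ls \<ge> 1/2"
    using \<sigma> by (auto simp: suleimanova_spectrum_def)
  define n where "n = length \<sigma>"
  have n: "n = Suc (length ls)" by (simp add: n_def ls(1))
  have h0: "hartley n i 0 * hartley n 0 j = 1 / real n"
    by (simp add: hartley_commute[of n 0 j])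
  have "0 \<le> 1 / real n + sum_list ls * (2 / real n)"
    using ls(3) n by (simp add: field_simps)
  also have "sum_list ls * (2 / real n) = (\<Sum>k<length ls. ls ! k * (2 / real n))"
    by (simp add: sum_list_sum_nth sum_distrib_right lessThan_atLeast0 sum_divide_distrib)
  also have "\<dots> \<le> (\<Sum>k<length ls. ls ! k * (hartley n i (Suc k) * hartley n (Suc k) j))"
    by (intro sum_mono mult_left_mono_neg hartley_mult_le ls(2)) simp
  also have "1 / real n + \<dots> = (\<Sum>k<n. \<sigma> ! k * (hartley n i k * hartley n k j))"
    unfolding n sum.lessThan_Suc_shift by (simp add: ls(1) h0[unfolded n] del: hartley_0_right)
  also have "\<dots> = hartley_conj \<sigma> $$ (i, j)"
    using i j by (simp add: n_def hartley_conj_index)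
  finally show ?thesis by simp
qed

theorem mainTheorem1:
  fixes n :: nat and \<sigma> :: "real list"
  assumes "n \<ge> 1"
    and "length \<sigma> = n"
    and "suleimanova_spectrum (1/2) \<sigma>"
  shows "\<exists>A \<in> carrier_mat n n.
           symmetric_mat A \<and> doubly_stochastic_mat A \<and> has_spectrum A \<sigma>"
proof (intro bexI conjI)
  let ?A = "hartley_conj \<sigma>"
  show sym: "symmetric_mat ?A" by (rule hartley_conj_symmetric)
  have "\<sigma> ! 0 = 1"
    using assms(3) by (auto simp: suleimanova_spectrum_def)
  then have "stochastic_mat ?A"
    using assms(3) by (simp add: stochastic_mat_def hartley_conj_nonneg hartley_conj_row_sum)
  then show "doubly_stochastic_mat ?A"
    using sym by (simp add: doubly_stochastic_mat_def symmetric_mat_def)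
  show "has_spectrum ?A \<sigma>" by (rule hartley_conj_has_spectrum)
  show "?A \<in> carrier_mat n n" using assms(2) hartley_conj_carrier[of \<sigma>] by simp
qed

end
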